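(* Let $S$ be a finite set. Then: (1) $\min_{f}|\mathcal{C}_{bij}(f)|=1$, the minimum being over all functions $f:S\to S$; (2) for $f:S\to S$, $|\mathcal{C}_{bij}(f)|=1$ if and only if no two distinct weakly connected components of $\Gamma(f)$ are isomorphic and for every weakly connected component $T=(T_0,\dots,T_{m-1})$ of $\Gamma(f)$ the following two conditions hold: (a) the index of $T$ is equal to $1$; (b) $|\mathrm{Aut}(T_i)|=1$ for every directed tree $T_i$ of $T$.
   Context: $\mathcal{C}_{bij}(f)$ is the set of permutations $g$ of $S$ with $fg=gf$. The functional graph $\Gamma(f)$ has vertex set $S$ and edges $[s,f(s)]$, $s\in S$. For finite $S$, each weakly connected component of $\Gamma(f)$ contains exactly one directed cycle $(z_0,\dots,z_{m-1})$ (possibly a loop; edges $z_i\to z_{i+1}$, indices mod $m$), and is denoted $(T_0,\dots,T_{m-1})$, where $T_i$ is the directed tree with root $z_i$ consisting of $z_i$ and all vertices whose forward path meets the cycle first at $z_i$. The order of $T=(T_0,\dots,T_{m-1})$ is the minimal positive integer $k$ such that $T_{i+k}\simeq T_i$ (as rooted directed trees) for all $i$ mod $m$; the index of $T$ is $m$ divided by the order. $\mathrm{Aut}(T_i)$ is the automorphism group of the rooted directed tree $T_i$. *)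

theory Defs
  imports
    "HOL-Library.FuncSet"
    "HOL-Combinatorics.Permutations"
    "Graph_Theory.Digraph_Isomorphism"
begin

text \<open>
  Only the values of \<open>f\<close> on \<open>S\<close> matter. Since \<open>g permutes S\<close> forces \<open>g\<close> to be the identity
  outside \<open>S\<close>, each permutation of \<open>S\<close> is counted once.
\<close>
definition C_bij :: "'a set \<Rightarrow> ('a \<Rightarrow> 'a) \<Rightarrow> ('a \<Rightarrow> 'a) set" where
  "C_bij S f = {g. g permutes S \<and> (\<forall>s\<in>S. f (g s) = g (f s))}"

definition functional_graph :: "'a set \<Rightarrow> ('a \<Rightarrow> 'a) \<Rightarrow> ('a, 'a \<times> 'a) pre_digraph" where
  "functional_graph S f = with_proj \<lparr>pverts = S, parcs = {(s, f s) |s. s \<in> S}\<rparr>"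

text \<open>
  The predicate \<open>connected\<close> of Graph_Theory is connectedness of the underlying symmetric graph
  and requires a nonempty vertex set.
\<close>
definition weak_components :: "('a, 'b) pre_digraph \<Rightarrow> ('a, 'b) pre_digraph set" where
  "weak_components G = {C. pre_digraph.max_subgraph G connected C}"

type_synonym ('a, 'b) rooted_digraph = "('a, 'b) pre_digraph \<times> 'a"

text \<open>
  \<open>rooted_isomorphism T U g\<close>: \<open>g\<close> is the vertex part of a digraph isomorphism from \<open>T\<close> to \<open>U\<close>
  that maps root to root.
\<close>
definition rooted_isomorphism ::
    "('a, 'b) rooted_digraph \<Rightarrow> ('a, 'b) rooted_digraph \<Rightarrow> ('a \<Rightarrow> 'a) \<Rightarrow> bool" where
  "rooted_isomorphism T U g \<longleftrightarrow>
     (\<exists>h. pre_digraph.digraph_isomorphism (fst T) h \<and> fst U = app_iso h (fst T) \<and>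
          iso_verts h = g \<and> g (snd T) = snd U)"

definition rooted_isomorphic ::
    "('a, 'b) rooted_digraph \<Rightarrow> ('a, 'b) rooted_digraph \<Rightarrow> bool" where
  "rooted_isomorphic T U \<longleftrightarrow> (\<exists>g. rooted_isomorphism T U g)"

text \<open>
  Automorphisms are recorded by their action on vertices, extended by the identity. The trees
  below have no parallel arcs, so this determines the action on arcs.
\<close>
definition rooted_Aut :: "('a, 'b) rooted_digraph \<Rightarrow> ('a \<Rightarrow> 'a) set" where
  "rooted_Aut T = {g. g permutes verts (fst T) \<and> rooted_isomorphism T T g}"

text \<open>
  Here \<open>p\<close> is a cycle of \<open>C\<close>, given as its list of arcs, and \<open>z\<close> a vertex on it. The vertices of
  the tree hanging at \<open>z\<close> are those with a walk to \<open>z\<close> on which only the last vertex lies on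
  the cycle. The arcs of \<open>p\<close> are removed so that the loop at \<open>z\<close> is not
  part of the tree when the cycle has length 1.
\<close>
definition hanging_tree ::
    "('a, 'b) pre_digraph \<Rightarrow> 'b awalk \<Rightarrow> 'a \<Rightarrow> ('a, 'b) rooted_digraph" where
  "hanging_tree C p z =
     (let V = {v. \<exists>q. pre_digraph.awalk C v q z \<and>
                      set (butlast (pre_digraph.awalk_verts C v q)) \<inter> tail C ` set p = {}};
          H = C \<restriction> V
      in (H\<lparr>arcs := arcs H - set p\<rparr>, z))"

text \<open>
  \<open>C = (T\<^sub>0, \<dots>, T\<^sub>m\<^sub>-\<^sub>1)\<close>. The cycle of a component of a finite functional graph is unique as a
  cyclic sequence, so the list of trees is unique up to rotation (choice of \<open>z\<^sub>0\<close>).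
\<close>
definition is_tree_tuple ::
    "('a, 'b) pre_digraph \<Rightarrow> ('a, 'b) rooted_digraph list \<Rightarrow> bool" where
  "is_tree_tuple C Ts \<longleftrightarrow>
     (\<exists>p. pre_digraph.cycle C p \<and> Ts = map (\<lambda>e. hanging_tree C p (tail C e)) p)"

definition tuple_order :: "('a, 'b) rooted_digraph list \<Rightarrow> nat" where
  "tuple_order Ts =
     (LEAST k. 0 < k \<and>
        (\<forall>i<length Ts. rooted_isomorphic (Ts ! ((i + k) mod length Ts)) (Ts ! i)))"

text \<open>The order always divides the length of the tuple, so the division is exact.\<close>
definition tuple_index :: "('a, 'b) rooted_digraph list \<Rightarrow> nat" where
  "tuple_index Ts = length Ts div tuple_order Ts"

end

theory Submission
  imports Defs
begin

text \<open>
  The vertices on the cycles of the functional graph of \<open>f\<close> are the periodic points of \<open>f\<close>, and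
  every \<open>x\<close> has a first periodic iterate, \<open>entry x\<close>. The fibre of \<open>entry\<close> over a periodic point
  \<open>z\<close>, its \<open>basin\<close>, is the vertex set of the tree hanging at \<open>z\<close>, so \<open>S\<close> is the disjoint union of
  these trees.

  A permutation \<open>g\<close> commuting with \<open>f\<close> satisfies \<open>entry (g x) = g (entry x)\<close>. Hence it permutes the
  periodic points, compatibly with \<open>f\<close>, and restricts to an isomorphism from the tree at \<open>z\<close> to the
  tree at \<open>g z\<close>. Conversely, an injection \<open>\<sigma>\<close> of the periodic points that commutes with \<open>f\<close>,
  together with an isomorphism from the tree at \<open>z\<close> to the tree at \<open>\<sigma> z\<close> for every \<open>z\<close>, can be glued
  to a permutation commuting with \<open>f\<close> (\<open>glue_basin_isos\<close>).

  Suppose that the three conditions hold and that \<open>g\<close> commutes with \<open>f\<close>. It maps each component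
  isomorphically onto a component, hence onto itself; on the cycle of a component it acts as a
  rotation, which carries each tree to an isomorphic one and is therefore trivial by the condition
  on the index; so \<open>g\<close> induces an automorphism on each tree, and these are trivial
  (\<open>C_bij_eq_id\<close>). If one of the conditions fails, there is a nontrivial commuting permutation: it
  exchanges two isomorphic components (\<open>not_iso_components\<close>), or it is glued from a proper rotation
  of a cycle (\<open>no_proper_shift\<close>), or from a nontrivial automorphism of a single tree
  (\<open>rooted_Aut_trivial\<close>).

  The identity always commutes with \<open>f\<close>, and it is the only permutation to do so when \<open>f\<close> is a
  directed path ending in a loop (\<open>ex_trivial_centralizer\<close>). So the minimum is \<open>1\<close>.
\<close>

section \<open>The index of a tuple of trees\<close>

text \<open>
  Let \<open>d\<close> be the order and \<open>m\<close> the length of the tuple. If \<open>m div d = 1\<close> but \<open>d < m\<close>, then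
  \<open>0 < m - d < d\<close>. By symmetry of isomorphism a shift by \<open>d\<close> can be undone, and modulo \<open>m\<close> undoing
  it is a shift by \<open>m - d\<close>; this contradicts the minimality of \<open>d\<close>.
\<close>
lemma tuple_index_eq_1_iff:
  assumes ne: "Ts \<noteq> []"
    and refl: "\<And>T. T \<in> set Ts \<Longrightarrow> rooted_isomorphic T T"
    and sym: "\<And>T U. T \<in> set Ts \<Longrightarrow> U \<in> set Ts \<Longrightarrow> rooted_isomorphic T U \<Longrightarrow> rooted_isomorphic U T"
  shows "tuple_index Ts = 1 \<longleftrightarrow>
    (\<forall>k. 0 < k \<and> k < length Ts \<longrightarrow>
      \<not> (\<forall>i<length Ts. rooted_isomorphic (Ts ! ((i + k) mod length Ts)) (Ts ! i)))"
    (is "_ \<longleftrightarrow> ?R")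
proof -
  let ?m = "length Ts"
  define P where "P k \<longleftrightarrow> 0 < k \<and>
    (\<forall>i<?m. rooted_isomorphic (Ts ! ((i + k) mod ?m)) (Ts ! i))" for k
  define d where "d = tuple_order Ts"
  have d: "d = (LEAST k. P k)" by (simp add: d_def tuple_order_def P_def)
  have m: "?m > 0" using ne by simp
  have Pm: "P ?m" using m refl by (simp add: P_def)
  have Pd: "P d" unfolding d using Pm by (rule LeastI)
  have min: "P k \<Longrightarrow> d \<le> k" for k unfolding d by (rule Least_le)
  have dm: "d \<le> ?m" using min[OF Pm] .
  have "?m div d = 1 \<longleftrightarrow> d = ?m"
  proof
    assume one: "?m div d = 1"
    show "d = ?m"
    proof (rule ccontr)
      assume "d \<noteq> ?m"
      then have "?m - d > 0" using dm by simp
      have "rooted_isomorphic (Ts ! ((i + (?m - d)) mod ?m)) (Ts ! i)" if i: "i < ?m" for i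
      proof -
        define j where "j = (i + (?m - d)) mod ?m"
        have "j < ?m" using m by (simp add: j_def)
        have "(j + d) mod ?m = i"
          using i dm by (simp add: j_def mod_add_left_eq)
        then have "rooted_isomorphic (Ts ! i) (Ts ! j)"
          using Pd \<open>j < ?m\<close> unfolding P_def by metis
        then show ?thesis using sym i \<open>j < ?m\<close> by (simp add: j_def[symmetric])
      qed
      then have "P (?m - d)" using \<open>?m - d > 0\<close> by (simp add: P_def)
      then have "d \<le> ?m - d" by (rule min)
      moreover have "?m = d + ?m mod d" using one by (metis div_mult_mod_eq mult_1)
      moreover have "?m mod d < d" using Pd by (simp add: P_def)
      ultimately show False by linarith
    qed
  next
    assume "d = ?m" then show "?m div d = 1" using m by simp
  qed
  also have "\<dots> \<longleftrightarrow> (\<forall>k. 0 < k \<and> k < ?m \<longrightarrow> \<not> P k)"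
    using min Pd dm unfolding P_def by (metis le_neq_implies_less leD)
  finally show ?thesis by (auto simp: tuple_index_def d_def P_def)
qed

section \<open>Periodic points, basins and components of a self-map\<close>

locale finite_self_map =
  fixes S :: "'a set" and f :: "'a \<Rightarrow> 'a"
  assumes finite_S: "finite S" and f_in: "s \<in> S \<Longrightarrow> f s \<in> S"
begin

definition periodic :: "'a \<Rightarrow> bool" where
  "periodic x \<longleftrightarrow> (\<exists>n>0. (f ^^ n) x = x)"

definition period :: "'a \<Rightarrow> nat" where
  "period x = (LEAST n. 0 < n \<and> (f ^^ n) x = x)"

text \<open>
  Every point of a finite \<open>S\<close> has a periodic iterate, see \<open>ex_periodic_iterate\<close>, so that the least
  number is attained there.
\<close>
definition entry :: "'a \<Rightarrow> 'a" where
  "entry x = (f ^^ (LEAST n. periodic ((f ^^ n) x))) x"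

definition basin :: "'a \<Rightarrow> 'a set" where
  "basin z = {v \<in> S. entry v = z}"

text \<open>
  Two points lie in the same weak component of the functional graph iff their forward orbits meet;
  see \<open>weak_components_eq\<close>.
\<close>
definition component :: "'a \<Rightarrow> 'a set" where
  "component x = {y \<in> S. \<exists>m n. (f ^^ m) x = (f ^^ n) y}"

lemma funpow_in: "x \<in> S \<Longrightarrow> (f ^^ n) x \<in> S"
  by (induction n) (auto intro: f_in)

lemma period_props:
  assumes "periodic z"
  shows "0 < period z" "(f ^^ period z) z = z"
    and "\<And>k. 0 < k \<Longrightarrow> k < period z \<Longrightarrow> (f ^^ k) z \<noteq> z"
proof -
  have "0 < period z \<and> (f ^^ period z) z = z"
    unfolding period_def by (rule LeastI_ex) (use assms in \<open>simp add: periodic_def\<close>)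
  then show "0 < period z" "(f ^^ period z) z = z" by auto
  show "(f ^^ k) z \<noteq> z" if "0 < k" "k < period z" for k
    using not_less_Least[of k "\<lambda>n. 0 < n \<and> (f ^^ n) z = z"] that unfolding period_def by auto
qed

lemma periodic_funpow: "periodic z \<Longrightarrow> periodic ((f ^^ k) z)"
  unfolding periodic_def by (metis add.commute comp_apply funpow_add)

lemma periodic_step: "periodic z \<Longrightarrow> periodic (f z)"
  using periodic_funpow[of z 1] by simp

text \<open>
  By the pigeonhole principle two iterates of \<open>x\<close> coincide, and the earlier of them is periodic.
\<close>
lemma ex_periodic_iterate:
  assumes "x \<in> S"
  shows "\<exists>n. periodic ((f ^^ n) x)"
proof -
  have "range (\<lambda>n. (f ^^ n) x) \<subseteq> S" using funpow_in[OF assms] by blast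
  then have "\<not> inj (\<lambda>n. (f ^^ n) x)"
    using finite_S finite_subset infinite_UNIV_nat finite_imageD by metis
  then obtain i j where "i < j" "(f ^^ i) x = (f ^^ j) x"
    unfolding inj_def by (metis nat_neq_iff)
  moreover from this have "(f ^^ (j - i)) ((f ^^ i) x) = (f ^^ j) x"
    by (metis add_diff_inverse_nat comp_apply funpow_add add.commute not_less_iff_gr_or_eq)
  ultimately show ?thesis unfolding periodic_def
    by (metis zero_less_diff)
qed

lemma entry_witness:
  assumes "x \<in> S"
  obtains n where "entry x = (f ^^ n) x" "periodic ((f ^^ n) x)"
    "\<And>j. j < n \<Longrightarrow> \<not> periodic ((f ^^ j) x)"
  using that[of "LEAST n. periodic ((f ^^ n) x)"] LeastI_ex[OF ex_periodic_iterate[OF assms]]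
    not_less_Least unfolding entry_def by blast

lemma entry_eqI:
  assumes "periodic ((f ^^ n) x)" "\<And>j. j < n \<Longrightarrow> \<not> periodic ((f ^^ j) x)"
  shows "entry x = (f ^^ n) x"
proof -
  have "(LEAST n. periodic ((f ^^ n) x)) = n"
    by (rule Least_equality) (use assms in \<open>auto simp: not_less[symmetric]\<close>)
  then show ?thesis by (simp add: entry_def)
qed

lemma entry_periodic: "x \<in> S \<Longrightarrow> periodic (entry x)"
  by (metis entry_witness)

lemma entry_in: "x \<in> S \<Longrightarrow> entry x \<in> S"
  by (metis entry_witness funpow_in)

lemma entry_of_periodic: "periodic x \<Longrightarrow> entry x = x"
  using entry_eqI[of 0 x] by simp

lemma entry_step:
  assumes "x \<in> S" "\<not> periodic x"
  shows "entry (f x) = entry x"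
proof -
  obtain n where n: "entry x = (f ^^ n) x" "periodic ((f ^^ n) x)"
    "\<And>j. j < n \<Longrightarrow> \<not> periodic ((f ^^ j) x)"
    using entry_witness[OF assms(1)] by blast
  then obtain k where k: "n = Suc k" using assms(2) by (cases n) auto
  have "entry (f x) = (f ^^ k) (f x)"
  proof (rule entry_eqI)
    show "periodic ((f ^^ k) (f x))" using n(2) k by (simp add: funpow_swap1[of f])
    show "\<not> periodic ((f ^^ j) (f x))" if "j < k" for j
      using n(3)[of "Suc j"] that k by (simp add: funpow_swap1[of f])
  qed
  then show ?thesis using n(1) k by (simp add: funpow_swap1[of f])
qed

lemma basin_subset: "basin z \<subseteq> S"
  by (auto simp: basin_def)

lemma root_in_basin: "z \<in> S \<Longrightarrow> periodic z \<Longrightarrow> z \<in> basin z"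
  by (simp add: basin_def entry_of_periodic)

lemma periodic_in_basin: "v \<in> basin z \<Longrightarrow> periodic v \<Longrightarrow> v = z"
  by (auto simp: basin_def entry_of_periodic)

lemma basin_step: "v \<in> basin z \<Longrightarrow> \<not> periodic v \<Longrightarrow> f v \<in> basin z"
  by (auto simp: basin_def entry_step f_in)

lemma component_subset: "component x \<subseteq> S"
  by (auto simp: component_def)

lemma component_refl: "x \<in> S \<Longrightarrow> x \<in> component x"
  by (auto simp: component_def)

lemma component_sym: "x \<in> S \<Longrightarrow> y \<in> component x \<Longrightarrow> x \<in> component y"
  unfolding component_def by auto metis

lemma component_trans:
  assumes "y \<in> component x" "w \<in> component y"
  shows "w \<in> component x"
proof -
  obtain a b c d where *: "(f ^^ a) x = (f ^^ b) y" "(f ^^ c) y = (f ^^ d) w"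
    using assms by (auto simp: component_def)
  have "(f ^^ (c + a)) x = (f ^^ (c + b)) y" by (simp add: funpow_add *)
  also have "\<dots> = (f ^^ (b + d)) w" by (simp add: funpow_add * add.commute[of c b])
  finally show ?thesis using assms(2) by (auto simp: component_def)
qed

lemma component_eq:
  assumes "x \<in> S" "y \<in> component x"
  shows "component y = component x"
  using component_trans[OF assms(2)] component_trans[OF component_sym[OF assms]] by blast

lemma funpow_in_component: "x \<in> S \<Longrightarrow> (f ^^ n) x \<in> component x"
  unfolding component_def using funpow_in funpow_0 by (metis (mono_tags, lifting) mem_Collect_eq)

lemma component_step: "y \<in> component x \<Longrightarrow> f y \<in> component x"
  using component_trans[OF _ funpow_in_component[of y 1]] component_subset by auto

lemma component_step_iff:
  assumes "y \<in> S"
  shows "f y \<in> component x \<longleftrightarrow> y \<in> component x"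
proof
  assume "f y \<in> component x"
  moreover have "y \<in> component (f y)"
    using component_sym[OF assms] funpow_in_component[OF assms, of 1] by simp
  ultimately show "y \<in> component x" by (rule component_trans)
qed (rule component_step)

lemma entry_in_component: "x \<in> S \<Longrightarrow> entry x \<in> component x"
  by (metis entry_witness funpow_in_component)

text \<open>
  If \<open>f\<close> iterated \<open>a\<close> times on \<open>z\<close> meets \<open>f\<close> iterated \<open>b\<close> times on \<open>w\<close>, then going on around the
  cycle of \<open>w\<close> leads from the meeting point to \<open>w\<close>.
\<close>
lemma periodic_same_component:
  assumes "periodic w" "w \<in> component z"
  shows "\<exists>r. w = (f ^^ r) z"
proof -
  obtain a b where ab: "(f ^^ a) z = (f ^^ b) w" using assms(2) by (auto simp: component_def)
  obtain q where q: "q > 0" "(f ^^ q) w = w" using assms(1) by (auto simp: periodic_def)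
  \<comment> \<open>\<open>b * q\<close> is a multiple of a period of \<open>w\<close> that is at least \<open>b\<close>.\<close>
  have "b \<le> b * q" using q(1) by simp
  then have "(f ^^ (b * q - b)) ((f ^^ b) w) = (f ^^ (b * q)) w"
    by (metis comp_apply funpow_add le_add_diff_inverse2)
  also have "\<dots> = w" using funpow_mod_eq[OF q(2), of "b * q"] by simp
  finally have "(f ^^ (b * q - b + a)) z = w" by (simp add: funpow_add ab)
  then show ?thesis by metis
qed

lemma periodic_same_component_less:
  assumes "periodic z" "periodic w" "w \<in> component z"
  shows "\<exists>r<period z. w = (f ^^ r) z"
  using periodic_same_component[OF assms(2,3)] funpow_mod_eq[OF period_props(2)[OF assms(1)]]
    period_props(1)[OF assms(1)] by (metis mod_less_divisor)

lemma inj_on_orbit: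
  assumes "periodic z"
  shows "inj_on (\<lambda>i. (f ^^ i) z) {..<period z}"
proof -
  have False if "i < j" "j < period z" "(f ^^ i) z = (f ^^ j) z" for i j
  proof -
    have "(f ^^ (period z - j + i)) z = (f ^^ (period z - j + j)) z"
      using that(3) by (simp add: funpow_add)
    also have "\<dots> = z" using that period_props(2)[OF assms] by simp
    finally show False using period_props(3)[OF assms, of "period z - j + i"] that by linarith
  qed
  then show ?thesis unfolding inj_on_def by (metis lessThan_iff nat_neq_iff)
qed

section \<open>Permutations commuting with the map\<close>

lemma C_bijD:
  assumes "g \<in> C_bij S f"
  shows "g permutes S" "\<And>x. x \<in> S \<Longrightarrow> g (f x) = f (g x)" "\<And>x. x \<in> S \<Longrightarrow> g x \<in> S"
  using assms permutes_in_image[of g S] by (auto simp: C_bij_def)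

lemma id_in_C_bij: "id \<in> C_bij S f"
  by (simp add: C_bij_def permutes_id)

lemma C_bij_funpow:
  assumes "g \<in> C_bij S f" "x \<in> S"
  shows "g ((f ^^ n) x) = (f ^^ n) (g x)"
  by (induction n) (simp_all add: C_bijD(2)[OF assms(1) funpow_in[OF assms(2)]])

lemma C_bij_inj: "g \<in> C_bij S f \<Longrightarrow> g x = g y \<longleftrightarrow> x = y"
  using C_bijD(1) permutes_inj inj_eq by metis

lemma C_bij_periodic:
  assumes "g \<in> C_bij S f" "x \<in> S"
  shows "periodic (g x) \<longleftrightarrow> periodic x"
  unfolding periodic_def by (simp add: C_bij_funpow[OF assms, symmetric] C_bij_inj[OF assms(1)])

lemma C_bij_entry:
  assumes "g \<in> C_bij S f" "x \<in> S"
  shows "entry (g x) = g (entry x)"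
proof -
  obtain n where n: "entry x = (f ^^ n) x" "periodic ((f ^^ n) x)"
    "\<And>j. j < n \<Longrightarrow> \<not> periodic ((f ^^ j) x)"
    using entry_witness[OF assms(2)] by blast
  have "entry (g x) = (f ^^ n) (g x)"
    by (rule entry_eqI)
      (use n assms in \<open>simp_all add: C_bij_funpow[symmetric] C_bij_periodic funpow_in\<close>)
  then show ?thesis using n(1) assms by (simp add: C_bij_funpow)
qed

text \<open>
  As \<open>g\<close> is a bijection of \<open>S\<close>, it suffices to know that \<open>A\<close> is the preimage of \<open>B\<close>. This gives the
  action of \<open>g\<close> on basins and on components alike.
\<close>
lemma C_bij_bij_betw:
  assumes g: "g \<in> C_bij S f" and "A \<subseteq> S" "B \<subseteq> S" "\<And>x. x \<in> S \<Longrightarrow> g x \<in> B \<longleftrightarrow> x \<in> A"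
  shows "bij_betw g A B"
proof (rule bij_betw_imageI)
  show "inj_on g A" using C_bij_inj[OF g] by (auto intro: inj_onI)
  show "g ` A = B"
  proof
    show "g ` A \<subseteq> B" using assms by auto
    show "B \<subseteq> g ` A"
    proof
      fix y assume "y \<in> B"
      then obtain x where "x \<in> S" "y = g x"
        using \<open>B \<subseteq> S\<close> permutes_image[OF C_bijD(1)[OF g]] by blast
      then show "y \<in> g ` A" using assms(4) \<open>y \<in> B\<close> by auto
    qed
  qed
qed

lemma C_bij_basin:
  assumes "g \<in> C_bij S f" "z \<in> S"
  shows "bij_betw g (basin z) (basin (g z))"
  by (rule C_bij_bij_betw[OF assms(1)])
    (use assms C_bijD(3) in \<open>auto simp: basin_def C_bij_entry C_bij_inj\<close>)

lemma C_bij_component: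
  assumes "g \<in> C_bij S f" "x \<in> S"
  shows "bij_betw g (component x) (component (g x))"
  by (rule C_bij_bij_betw[OF assms(1)])
    (use assms C_bijD(3) in
      \<open>auto simp: component_def C_bij_funpow[symmetric] C_bij_inj\<close>)

lemma in_C_bijI:
  assumes "\<And>x. x \<in> S \<Longrightarrow> g x \<in> S" "inj_on g S" "\<And>x. x \<notin> S \<Longrightarrow> g x = x"
    and "\<And>x. x \<in> S \<Longrightarrow> g (f x) = f (g x)"
  shows "g \<in> C_bij S f"
proof -
  have "g ` S = S" using assms(1,2) finite_S by (intro endo_inj_surj) auto
  then have "g permutes S" using assms by (intro bij_imp_permutes) (auto simp: bij_betw_def)
  then show ?thesis using assms by (simp add: C_bij_def)
qed

text \<open>
  This is isomorphism of the rooted trees on the two basins, expressed through \<open>f\<close>; see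
  \<open>rooted_isomorphism_basin_tree_iff\<close>. The root is exempt from commuting with \<open>f\<close> because its
  outgoing edge belongs to the cycle and not to the tree.
\<close>
definition basin_iso :: "'a \<Rightarrow> 'a \<Rightarrow> ('a \<Rightarrow> 'a) \<Rightarrow> bool" where
  "basin_iso z w h \<longleftrightarrow> bij_betw h (basin z) (basin w) \<and> h z = w \<and>
     (\<forall>v \<in> basin z. \<not> periodic v \<longrightarrow> h (f v) = f (h v))"

lemma basin_iso_id: "basin_iso z z id"
  by (simp add: basin_iso_def)

lemma basin_iso_inv:
  assumes "basin_iso z w h" "z \<in> S" "periodic z" "w \<in> S" "periodic w"
  shows "basin_iso w z (inv_into (basin z) h)"
  unfolding basin_iso_def
proof (intro conjI ballI impI)
  let ?k = "inv_into (basin z) h"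
  have h: "bij_betw h (basin z) (basin w)" "h z = w" using assms by (auto simp: basin_iso_def)
  show "bij_betw ?k (basin w) (basin z)" using h(1) by (rule bij_betw_inv_into)
  show "?k w = z" using bij_betw_inv_into_left[OF h(1) root_in_basin] h(2) assms by blast
  fix v assume v: "v \<in> basin w" "\<not> periodic v"
  define u where "u = ?k v"
  have u: "u \<in> basin z" "h u = v"
    using v h(1) unfolding u_def
    by (auto simp: bij_betw_inv_into_right bij_betw_def inv_into_into)
  have "u \<noteq> z" using u(2) h(2) v(2) assms by auto
  then have nu: "\<not> periodic u" using u(1) periodic_in_basin by blast
  then have "h (f u) = f v" using assms(1) u by (auto simp: basin_iso_def)
  then show "?k (f v) = f (?k v)"
    using bij_betw_inv_into_left[OF h(1) basin_step[OF u(1) nu]] u_def by simp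
qed

lemma C_bij_basin_iso:
  assumes "g \<in> C_bij S f" "z \<in> S"
  shows "basin_iso z (g z) g"
  using C_bij_basin[OF assms] C_bijD(2)[OF assms(1)] basin_subset by (auto simp: basin_iso_def)

text \<open>
  Off the cycles, \<open>x\<close> and \<open>f x\<close> lie in the same basin and \<open>h (entry x)\<close> commutes with \<open>f\<close> at \<open>x\<close>.
  On the cycles, the glued map is \<open>\<sigma>\<close>. It is injective because basins with different roots are
  sent to basins with different roots.
\<close>
lemma glue_basin_isos:
  assumes iso: "\<And>z. z \<in> S \<Longrightarrow> periodic z \<Longrightarrow> basin_iso z (\<sigma> z) (h z)"
    and inj: "inj_on \<sigma> {z \<in> S. periodic z}"
    and comm: "\<And>z. z \<in> S \<Longrightarrow> periodic z \<Longrightarrow> \<sigma> (f z) = f (\<sigma> z)"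
  shows "(\<lambda>x. if x \<in> S then h (entry x) x else x) \<in> C_bij S f" (is "?g \<in> _")
proof (rule in_C_bijI)
  have iso': "basin_iso (entry x) (\<sigma> (entry x)) (h (entry x))" if "x \<in> S" for x
    using iso entry_in entry_periodic that by blast
  have own: "x \<in> basin (entry x)" if "x \<in> S" for x using that by (simp add: basin_def)
  have mem: "?g x \<in> basin (\<sigma> (entry x))" if "x \<in> S" for x
    using iso'[OF that] own[OF that] that by (auto simp: basin_iso_def bij_betw_def)
  then show "?g x \<in> S" if "x \<in> S" for x using that basin_subset by blast
  show "?g x = x" if "x \<notin> S" for x using that by simp
  show "inj_on ?g S"
  proof (rule inj_onI)
    fix x y assume xy: "x \<in> S" "y \<in> S" "?g x = ?g y"
    have "\<sigma> (entry x) = \<sigma> (entry y)"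
      using mem[OF xy(1)] mem[OF xy(2)] xy(3) by (simp add: basin_def)
    then have e: "entry x = entry y"
      using inj_onD[OF inj] entry_in entry_periodic xy by blast
    then show "x = y" using xy iso'[OF xy(1)] own[OF xy(1)] own[OF xy(2)]
      by (auto simp: basin_iso_def bij_betw_def dest: inj_onD)
  qed
  show "?g (f x) = f (?g x)" if x: "x \<in> S" for x
  proof (cases "periodic x")
    case True
    have "h z z = \<sigma> z" if "z \<in> S" "periodic z" for z
      using iso[OF that] by (simp add: basin_iso_def)
    then show ?thesis
      using True x f_in[OF x] periodic_step[OF True] comm[OF x True] by (simp add: entry_of_periodic)
  next
    case False
    then show ?thesis
      using iso'[OF x] own[OF x] x f_in[OF x] entry_step[OF x False] by (simp add: basin_iso_def)
  qed
qed

section \<open>Weak components of the functional graph\<close>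

abbreviation "\<Gamma> \<equiv> functional_graph S f"

lemma functional_graph_simps [simp]:
  "verts \<Gamma> = S" "arcs \<Gamma> = {(s, f s) |s. s \<in> S}" "tail \<Gamma> = fst" "head \<Gamma> = snd"
  by (auto simp: functional_graph_def)

lemma wf_functional_graph: "wf_digraph \<Gamma>"
  by unfold_locales (auto intro: f_in)

text \<open>
  An edge joins \<open>s\<close> and \<open>f s\<close>, which lie in the same component, so no undirected walk leaves it.
\<close>
lemma connected_subgraph_in_component:
  assumes "subgraph H \<Gamma>" "connected H" "x \<in> verts H"
  shows "verts H \<subseteq> component x"
proof
  fix y assume "y \<in> verts H"
  have HS: "verts H \<subseteq> S" using assms(1) by (auto simp: subgraph_def)
  have ends: "arcs_ends H \<subseteq> {(s, f s) |s. s \<in> S}"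
    using arcs_ends_mono[OF assms(1)] by (auto simp: arcs_ends_conv)
  have "(x, y) \<in> rtrancl_on (verts H) ((arcs_ends H)\<^sup>s)"
    using assms \<open>y \<in> verts H\<close> by (simp add: connected_conv)
  then show "y \<in> component x"
  proof (induction rule: rtrancl_on_induct)
    case base
    then show ?case using HS component_refl by blast
  next
    case (step u v)
    then show ?case using ends component_step component_step_iff by (auto simp: symcl_def)
  qed
qed

text \<open>
  Walk forward from \<open>u\<close> to a point where the orbits of \<open>u\<close> and \<open>v\<close> meet, then backward to \<open>v\<close>.
\<close>
lemma connected_component_graph:
  assumes "x \<in> S"
  shows "connected (\<Gamma> \<restriction> component x)"
proof -
  let ?K = "component x" and ?R = "(arcs_ends (\<Gamma> \<restriction> component x))\<^sup>s"
  have edge: "(u, f u) \<in> ?R" "(f u, u) \<in> ?R" if "u \<in> ?K" for u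
    using that component_subset component_step[OF that]
    by (force simp: symcl_def arcs_ends_conv)+
  have it: "u \<in> ?K \<Longrightarrow> (f ^^ n) u \<in> ?K" for u n
    by (induction n) (auto intro: component_step)
  have fwd: "(u, (f ^^ n) u) \<in> rtrancl_on ?K ?R" if "u \<in> ?K" for u n
  proof (induction n)
    case (Suc n)
    then show ?case
      using edge(1)[OF it[OF that, of n]] component_step[OF it[OF that, of n]]
      by (simp add: rtrancl_on_into_rtrancl_on)
  qed (use that in auto)
  have bwd: "((f ^^ n) u, u) \<in> rtrancl_on ?K ?R" if "u \<in> ?K" for u n
  proof (induction n)
    case (Suc n)
    then show ?case
      using edge(2)[OF it[OF that, of n]] component_step[OF it[OF that, of n]]
      by (simp add: converse_rtrancl_on_into_rtrancl_on)
  qed (use that in auto)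
  have "(u, v) \<in> rtrancl_on ?K ?R" if "u \<in> ?K" "v \<in> ?K" for u v
  proof -
    have "v \<in> component u" using that component_eq[OF assms] by blast
    then obtain m n where "(f ^^ m) u = (f ^^ n) v" by (auto simp: component_def)
    then show ?thesis using rtrancl_on_trans fwd bwd that by metis
  qed
  then show ?thesis using component_refl[OF assms] by (auto simp: connected_conv)
qed

lemma weak_components_eq: "weak_components \<Gamma> = (\<lambda>x. \<Gamma> \<restriction> component x) ` S"
proof (intro set_eqI iffI)
  interpret G: wf_digraph \<Gamma> by (rule wf_functional_graph)
  have sub: "subgraph (\<Gamma> \<restriction> component x) \<Gamma>" for x
    by (rule G.subgraph_induce_subgraphI) (simp add: component_subset)
  have below: "subgraph H (\<Gamma> \<restriction> component x)"
    if "subgraph H \<Gamma>" "connected H" "x \<in> verts H" for H x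
    using connected_subgraph_in_component[OF that] that(1) G.wellformed_induce_subgraph
    by (auto simp: subgraph_def compatible_def dest: wf_digraph.wellformed)
  fix C
  { assume "C \<in> weak_components \<Gamma>"
    then have C: "G.max_subgraph connected C" by (simp add: weak_components_def)
    then have sC: "subgraph C \<Gamma>" "connected C" by (auto simp: G.max_subgraph_def)
    then obtain x where x: "x \<in> verts C" by (auto simp: connected_conv)
    then have "x \<in> S" using sC(1) by (auto simp: subgraph_def)
    then have "C = \<Gamma> \<restriction> component x"
      using C below[OF sC x] sub connected_component_graph unfolding G.max_subgraph_def by metis
    then show "C \<in> (\<lambda>x. \<Gamma> \<restriction> component x) ` S" using \<open>x \<in> S\<close> by blast }
  { assume "C \<in> (\<lambda>x. \<Gamma> \<restriction> component x) ` S"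
    then obtain x where x: "x \<in> S" "C = \<Gamma> \<restriction> component x" by blast
    have "D = C" if "subgraph C D" "subgraph D \<Gamma>" "connected D" for D
    proof -
      have "x \<in> verts D" using that(1) x component_refl by (auto simp: subgraph_def)
      then have "subgraph D C" using below that x by blast
      then show ?thesis using that(1)
        by (intro pre_digraph.equality) (auto simp: subgraph_def compatible_def)
    qed
    then show "C \<in> weak_components \<Gamma>"
      using x sub connected_component_graph by (auto simp: weak_components_def G.max_subgraph_def) }
qed

text \<open>
  Each vertex \<open>v\<close> has exactly one outgoing arc, \<open>(v, f v)\<close>. So an isomorphism is determined by its
  action on vertices, and preserving arcs amounts to commuting with \<open>f\<close>.
\<close>
lemma digraph_iso_component_iff:
  "digraph_iso (\<Gamma> \<restriction> component x) (\<Gamma> \<restriction> component y) \<longleftrightarrow>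
     (\<exists>h. bij_betw h (component x) (component y) \<and> (\<forall>v \<in> component x. h (f v) = f (h v)))"
    (is "?L \<longleftrightarrow> ?R")
proof -
  have arcs: "arcs (\<Gamma> \<restriction> component w) = (\<lambda>v. (v, f v)) ` component w" for w
    using component_subset component_step by auto
  interpret wf_digraph "\<Gamma> \<restriction> component x"
    using wf_digraph.wellformed_induce_subgraph[OF wf_functional_graph] .
  show ?thesis
  proof
    assume ?L
    then obtain k where k: "digraph_isomorphism k"
      and eq: "\<Gamma> \<restriction> component y = app_iso k (\<Gamma> \<restriction> component x)"
      unfolding digraph_iso_def by blast
    have t: "iso_tail k = fst" "iso_head k = snd"
      using arg_cong[OF eq, of tail] arg_cong[OF eq, of head] by auto
    have im: "iso_verts k ` component x = component y"
      using arg_cong[OF eq, of verts] by simp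
    have ia: "iso_arcs k ` (\<lambda>v. (v, f v)) ` component x = (\<lambda>v. (v, f v)) ` component y"
      using arg_cong[OF eq, of arcs] unfolding arcs_app_iso arcs by simp
    have "iso_verts k (f v) = f (iso_verts k v)" if v: "v \<in> component x" for v
    proof -
      have a: "(v, f v) \<in> arcs (\<Gamma> \<restriction> component x)" using v arcs by blast
      obtain u where u: "iso_arcs k (v, f v) = (u, f u)" using ia v by blast
      show ?thesis
        using iso_verts_tail[OF k a] iso_verts_head[OF k a] u t by simp
    qed
    then show ?R using im digraph_isomorphism_inj_on_verts[OF k] by (auto simp: bij_betw_def)
  next
    assume ?R
    then obtain h where h: "bij_betw h (component x) (component y)"
      "\<And>v. v \<in> component x \<Longrightarrow> h (f v) = f (h v)" by blast
    let ?k = "\<lparr>iso_verts = h, iso_arcs = map_prod h h, iso_head = snd, iso_tail = fst\<rparr>"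
    have "digraph_isomorphism ?k"
      unfolding digraph_isomorphism_def
    proof (intro conjI ballI)
      show "inj_on (iso_verts ?k) (verts (\<Gamma> \<restriction> component x))"
        using h(1) by (simp add: bij_betw_def)
      show "inj_on (iso_arcs ?k) (arcs (\<Gamma> \<restriction> component x))"
        unfolding arcs using h(1) by (auto simp: bij_betw_def inj_on_def)
      fix a assume "a \<in> arcs (\<Gamma> \<restriction> component x)"
      then obtain v where "v \<in> component x" "a = (v, f v)" unfolding arcs by blast
      then show "iso_verts ?k (tail (\<Gamma> \<restriction> component x) a) = iso_tail ?k (iso_arcs ?k a)"
        "iso_verts ?k (head (\<Gamma> \<restriction> component x) a) = iso_head ?k (iso_arcs ?k a)"
        using h(2) by simp_all
    qed (rule wf_digraph)
    moreover have "map_prod h h ` (\<lambda>v. (v, f v)) ` component x = (\<lambda>v. (v, f v)) ` h ` component x"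
      unfolding image_image by (rule image_cong) (use h(2) in auto)
    then have "\<Gamma> \<restriction> component y = app_iso ?k (\<Gamma> \<restriction> component x)"
      using h(1) unfolding app_iso_def arcs
      by (intro pre_digraph.equality) (simp_all add: bij_betw_def arcs del: induce_subgraph_arcs)
    ultimately show ?L unfolding digraph_iso_def by blast
  qed
qed

section \<open>Cycles and hanging trees\<close>

definition basin_tree :: "'a \<Rightarrow> ('a, 'a \<times> 'a) rooted_digraph" where
  "basin_tree z =
     (\<lparr>verts = basin z, arcs = {(v, f v) |v. v \<in> basin z \<and> \<not> periodic v},
       tail = fst, head = snd\<rparr>, z)"

definition orbit_walk :: "'a \<Rightarrow> nat \<Rightarrow> ('a \<times> 'a) list" where
  "orbit_walk u n = map (\<lambda>i. ((f ^^ i) u, (f ^^ Suc i) u)) [0..<n]"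

lemma orbit_walk_Suc: "orbit_walk u (Suc n) = (u, f u) # orbit_walk (f u) n"
  unfolding orbit_walk_def map_upt_Suc by (simp add: funpow_Suc_right del: funpow.simps)

text \<open>
  Since each vertex has one outgoing arc, a walk is determined by its start and its length.
\<close>
lemma awalk_component_iff:
  assumes "x \<in> S"
  shows "pre_digraph.awalk (\<Gamma> \<restriction> component x) u p v \<longleftrightarrow>
    u \<in> component x \<and> p = orbit_walk u (length p) \<and> v = (f ^^ length p) u"
proof -
  interpret wf_digraph "\<Gamma> \<restriction> component x"
    using wf_digraph.wellformed_induce_subgraph[OF wf_functional_graph] .
  show ?thesis
  proof (induction p arbitrary: u)
    case Nil
    then show ?case by (auto simp: awalk_Nil_iff orbit_walk_def)
  next
    case (Cons e p)
    show ?case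
      using component_subset component_step
      by (auto simp: awalk_Cons_iff Cons orbit_walk_Suc funpow_swap1[of f])
  qed
qed

lemma awalk_verts_orbit_walk:
  "pre_digraph.awalk_verts (\<Gamma> \<restriction> component x) u (orbit_walk u n) = map (\<lambda>i. (f ^^ i) u) [0..<Suc n]"
proof (induction n arbitrary: u)
  case 0
  then show ?case by (simp add: orbit_walk_def pre_digraph.awalk_verts.simps)
next
  case (Suc n)
  show ?case
    unfolding orbit_walk_Suc
    unfolding map_upt_Suc[of _ "Suc n"] pre_digraph.awalk_verts.simps
    by (simp add: Suc funpow_Suc_right del: upt_Suc funpow.simps)
qed

lemma length_orbit_walk [simp]: "length (orbit_walk u n) = n"
  by (simp add: orbit_walk_def)

text \<open>
  A closed walk from \<open>u\<close> of positive length \<open>n\<close> makes \<open>u\<close> periodic, and its vertices are distinct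
  exactly if \<open>n\<close> is the least period.
\<close>
lemma cycle_component_iff:
  assumes x: "x \<in> S"
  shows "pre_digraph.cycle (\<Gamma> \<restriction> component x) p \<longleftrightarrow>
    (\<exists>z \<in> component x. periodic z \<and> p = orbit_walk z (period z))" (is "?L \<longleftrightarrow> ?R")
proof
  have tl_verts: "tl (pre_digraph.awalk_verts (\<Gamma> \<restriction> component x) u (orbit_walk u n)) =
      map (\<lambda>i. (f ^^ Suc i) u) [0..<n]" for u n
    unfolding awalk_verts_orbit_walk
    by (simp add: map_upt_Suc del: upt_Suc)
  { assume ?L
    then obtain u n where u: "u \<in> component x" "p = orbit_walk u n" "u = (f ^^ n) u" "n > 0"
      and dist: "distinct (map (\<lambda>i. (f ^^ Suc i) u) [0..<n])"
      unfolding pre_digraph.cycle_def awalk_component_iff[OF x]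
      by (metis tl_verts length_greater_0_conv)
    then have per: "periodic u" by (metis periodic_def)
    have "\<not> n < period u" using period_props(3)[OF per, of n] u by auto
    moreover have "\<not> period u < n"
    proof
      assume "period u < n"
      moreover have "(f ^^ Suc (period u)) u = (f ^^ Suc 0) u"
        using period_props(2)[OF per] by simp
      ultimately show False
        using dist period_props(1)[OF per] inj_onD[of "\<lambda>i. (f ^^ Suc i) u" "{0..<n}" "period u" 0]
        by (auto simp: distinct_map)
    qed
    ultimately have "n = period u" by simp
    then show ?R using u per by blast }
  { assume ?R
    then obtain z where z: "z \<in> component x" "periodic z" and p: "p = orbit_walk z (period z)"
      by blast
    let ?m = "period z"
    have "inj_on (\<lambda>i. (f ^^ Suc i) z) {..<?m}"
    proof (rule inj_onI)
      fix i j assume ij: "i \<in> {..<?m}" "j \<in> {..<?m}" "(f ^^ Suc i) z = (f ^^ Suc j) z"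
      \<comment> \<open>On the cycle, \<open>f\<close> is inverted by \<open>?m - 1\<close> further steps.\<close>
      have returns: "(f ^^ (?m - 1)) ((f ^^ Suc k) z) = (f ^^ k) z" for k
      proof -
        have "?m - 1 + Suc k = k + ?m" using period_props(1)[OF z(2)] by simp
        then have "(f ^^ (?m - 1)) ((f ^^ Suc k) z) = (f ^^ (k + ?m)) z"
          by (metis comp_apply funpow_add)
        then show ?thesis using period_props(2)[OF z(2)] by (simp add: funpow_add)
      qed
      have "(f ^^ i) z = (f ^^ j) z" using ij(3) returns by metis
      then show "i = j" using inj_onD[OF inj_on_orbit[OF z(2)]] ij by blast
    qed
    then have "distinct (map (\<lambda>i. (f ^^ Suc i) z) [0..<?m])"
      by (simp add: distinct_map lessThan_atLeast0)
    moreover have "p \<noteq> []" using p period_props(1)[OF z(2)] by (metis length_orbit_walk less_irrefl list.size(3))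
    moreover have "pre_digraph.awalk (\<Gamma> \<restriction> component x) z p z"
      using z p period_props(2)[OF z(2)] by (simp add: awalk_component_iff[OF x])
    ultimately show ?L unfolding pre_digraph.cycle_def using tl_verts p by metis }
qed

lemma orbit_eq_periodic_component:
  assumes "x \<in> S" "z \<in> component x" "periodic z"
  shows "fst ` set (orbit_walk z (period z)) = {w \<in> component x. periodic w}"
proof -
  have z: "z \<in> S" "component z = component x"
    using assms component_subset component_eq by auto
  have "fst ` set (orbit_walk z (period z)) = (\<lambda>i. (f ^^ i) z) ` {..<period z}"
    by (auto simp: orbit_walk_def image_image lessThan_atLeast0)
  also have "\<dots> = {w \<in> component x. periodic w}"
    using periodic_same_component_less[OF assms(3)] periodic_funpow[OF assms(3)]
      funpow_in_component[OF z(1)] z(2) by auto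
  finally show ?thesis .
qed

text \<open>
  Walks follow the forward orbit, so a walk to \<open>w\<close> with only its last vertex on the cycle says that
  \<open>w\<close> is the first periodic iterate of the starting vertex. Among the basin vertices only the root is
  periodic, so deleting the cycle arcs removes at most the loop at the root.
\<close>
lemma hanging_tree_eq_basin_tree:
  assumes x: "x \<in> S" and z: "z \<in> component x" "periodic z" and w: "w \<in> component x" "periodic w"
  shows "hanging_tree (\<Gamma> \<restriction> component x) (orbit_walk z (period z)) w = basin_tree w"
proof -
  let ?C = "\<Gamma> \<restriction> component x" and ?p = "orbit_walk z (period z)"
  let ?V = "{v. \<exists>q. pre_digraph.awalk ?C v q w \<and>
    set (butlast (pre_digraph.awalk_verts ?C v q)) \<inter> tail ?C ` set ?p = {}}"
  have Z: "tail ?C ` set ?p = {w \<in> component x. periodic w}"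
    using orbit_eq_periodic_component[OF x z] by simp
  have wS: "w \<in> S" "component w = component x" using w x component_subset component_eq by auto
  have in_V: "v \<in> ?V \<longleftrightarrow> v \<in> component x \<and> (\<exists>n. w = (f ^^ n) v \<and> (\<forall>j<n. \<not> periodic ((f ^^ j) v)))" for v
  proof -
    have in_comp: "(f ^^ j) v \<in> component x" if "v \<in> component x" for j
      using that by (induction j) (auto intro: component_step)
    have "v \<in> ?V \<longleftrightarrow> v \<in> component x \<and>
      (\<exists>n. w = (f ^^ n) v \<and> set (map (\<lambda>i. (f ^^ i) v) [0..<n]) \<inter> {w \<in> component x. periodic w} = {})"
      unfolding Z mem_Collect_eq awalk_component_iff[OF x]
    proof (intro iffI; (elim exE conjE)?)
      fix q assume "v \<in> component x" and q: "q = orbit_walk v (length q)" and "w = (f ^^ length q) v"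
        and "set (butlast (pre_digraph.awalk_verts ?C v q)) \<inter> {w \<in> component x. periodic w} = {}"
      moreover have "butlast (pre_digraph.awalk_verts ?C v q) = map (\<lambda>i. (f ^^ i) v) [0..<length q]"
        by (subst q, subst awalk_verts_orbit_walk) simp
      ultimately show "v \<in> component x \<and>
        (\<exists>n. w = (f ^^ n) v \<and> set (map (\<lambda>i. (f ^^ i) v) [0..<n]) \<inter> {w \<in> component x. periodic w} = {})"
        by auto
    next
      fix n assume "v \<in> component x" "w = (f ^^ n) v"
        "set (map (\<lambda>i. (f ^^ i) v) [0..<n]) \<inter> {w \<in> component x. periodic w} = {}"
      then show "\<exists>q. (v \<in> component x \<and> q = orbit_walk v (length q) \<and> w = (f ^^ length q) v) \<and>
        set (butlast (pre_digraph.awalk_verts ?C v q)) \<inter> {w \<in> component x. periodic w} = {}"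
        by (intro exI[of _ "orbit_walk v n"]) (simp add: awalk_verts_orbit_walk)
    qed
    also have "\<dots> \<longleftrightarrow> v \<in> component x \<and> (\<exists>n. w = (f ^^ n) v \<and> (\<forall>j<n. \<not> periodic ((f ^^ j) v)))"
      (is "_ \<and> ?a \<longleftrightarrow> _ \<and> ?b")
    proof (rule conj_cong[OF HOL.refl])
      assume v: "v \<in> component x"
      have "set (map (\<lambda>i. (f ^^ i) v) [0..<n]) \<inter> {w \<in> component x. periodic w} = {} \<longleftrightarrow>
          (\<forall>j<n. \<not> periodic ((f ^^ j) v))" for n
        using in_comp[OF v] by (auto simp: disjoint_iff)
      then show "?a \<longleftrightarrow> ?b" by simp
    qed
    finally show ?thesis .
  qed
  have in_basin: "v \<in> basin w \<longleftrightarrow>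
      v \<in> component x \<and> (\<exists>n. w = (f ^^ n) v \<and> (\<forall>j<n. \<not> periodic ((f ^^ j) v)))" (is "_ \<longleftrightarrow> ?r v") for v
  proof
    assume v: "v \<in> basin w"
    then have vS: "v \<in> S" "entry v = w" by (auto simp: basin_def)
    then have "v \<in> component x"
      using component_sym[OF vS(1) entry_in_component[OF vS(1)]] wS by simp
    then show "?r v" using entry_witness[OF vS(1)] vS(2) by metis
  next
    assume "?r v"
    then obtain n where "v \<in> component x" "w = (f ^^ n) v" "\<forall>j<n. \<not> periodic ((f ^^ j) v)" by blast
    then show "v \<in> basin w" using entry_eqI[of n v] w(2) component_subset by (auto simp: basin_def)
  qed
  have V: "?V = basin w" by (rule set_eqI) (simp only: in_V in_basin)
  have pset: "set ?p = {(v, f v) |v. v \<in> component x \<and> periodic v}"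
  proof -
    have "set ?p = (\<lambda>v. (v, f v)) ` fst ` set ?p" by (force simp: orbit_walk_def)
    then show ?thesis using Z by auto
  qed
  have sub: "basin w \<subseteq> component x"
    using V by (auto simp: awalk_component_iff[OF x])
  have "arcs (?C \<restriction> basin w) - set ?p = {(v, f v) |v. v \<in> basin w \<and> \<not> periodic v}"
    using sub basin_subset basin_step component_step unfolding pset by fastforce
  then show ?thesis
    unfolding hanging_tree_def Let_def V basin_tree_def by (simp add: induce_subgraph_def)
qed

lemma is_tree_tuple_component_iff:
  assumes "x \<in> S"
  shows "is_tree_tuple (\<Gamma> \<restriction> component x) Ts \<longleftrightarrow>
    (\<exists>z \<in> component x. periodic z \<and> Ts = map (\<lambda>i. basin_tree ((f ^^ i) z)) [0..<period z])"
proof -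
  have "map (\<lambda>e. hanging_tree (\<Gamma> \<restriction> component x) (orbit_walk z (period z))
        (tail (\<Gamma> \<restriction> component x) e)) (orbit_walk z (period z)) =
      map (\<lambda>i. basin_tree ((f ^^ i) z)) [0..<period z]" if z: "z \<in> component x" "periodic z" for z
  proof -
    have "(f ^^ i) z \<in> component x" for i
      using z component_step by (induction i) auto
    then show ?thesis
      using hanging_tree_eq_basin_tree[OF assms z] periodic_funpow[OF z(2)]
      by (simp add: orbit_walk_def[of z "period z"])
  qed
  then show ?thesis unfolding is_tree_tuple_def cycle_component_iff[OF assms] by metis
qed

text \<open>
  A tree isomorphism is determined by its action on vertices, because each vertex other than the
  root has exactly one outgoing arc. It matches the roots, hence the nonperiodic vertices, hence the
  arcs.
\<close>
lemma rooted_isomorphism_basin_tree_iff: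
  assumes z: "z \<in> S" "periodic z" and w: "w \<in> S" "periodic w"
  shows "rooted_isomorphism (basin_tree z) (basin_tree w) h \<longleftrightarrow> basin_iso z w h" (is "?L \<longleftrightarrow> ?R")
proof -
  let ?A = "\<lambda>z. (\<lambda>v. (v, f v)) ` {v \<in> basin z. \<not> periodic v}"
  let ?G = "\<lambda>z. \<lparr>verts = basin z, arcs = ?A z, tail = fst, head = snd\<rparr>"
  have bt: "basin_tree z = (?G z, z)" for z by (auto simp: basin_tree_def)
  interpret wf_digraph "?G z"
    by unfold_locales (auto intro: basin_step)
  show ?thesis
  proof
    assume ?L
    then obtain k where k: "digraph_isomorphism k" and eq: "?G w = app_iso k (?G z)"
      and h: "iso_verts k = h" "h z = w"
      unfolding rooted_isomorphism_def bt by auto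
    have t: "iso_tail k = fst" "iso_head k = snd"
      using arg_cong[OF eq, of tail] arg_cong[OF eq, of head] by auto
    have im: "h ` basin z = basin w"
      using arg_cong[OF eq, of verts] h by simp
    have ia: "iso_arcs k ` ?A z = ?A w"
      using arg_cong[OF eq, of arcs] by simp
    have "h (f v) = f (h v)" if v: "v \<in> basin z" "\<not> periodic v" for v
    proof -
      have a: "(v, f v) \<in> arcs (?G z)" using v by simp
      obtain u where u: "iso_arcs k (v, f v) = (u, f u)" using ia v by blast
      show ?thesis
        using iso_verts_tail[OF k a] iso_verts_head[OF k a] u t h by simp
    qed
    then show ?R
      using im h digraph_isomorphism_inj_on_verts[OF k] by (auto simp: bij_betw_def basin_iso_def)
  next
    assume R: ?R
    then have h: "bij_betw h (basin z) (basin w)" "h z = w"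
      "\<And>v. v \<in> basin z \<Longrightarrow> \<not> periodic v \<Longrightarrow> h (f v) = f (h v)" by (auto simp: basin_iso_def)
    let ?k = "\<lparr>iso_verts = h, iso_arcs = map_prod h h, iso_head = snd, iso_tail = fst\<rparr>"
    have "digraph_isomorphism ?k"
      using h wf_digraph unfolding digraph_isomorphism_def
      by (auto simp: bij_betw_def inj_on_def)
    moreover have "map_prod h h ` ?A z = ?A w"
    proof -
      have "h ` {v \<in> basin z. \<not> periodic v} = {v \<in> basin w. \<not> periodic v}"
      proof -
        have "{v \<in> basin z. \<not> periodic v} = basin z - {z}" "{v \<in> basin w. \<not> periodic v} = basin w - {w}"
          using z w periodic_in_basin by auto
        moreover have "h ` (basin z - {z}) = basin w - {w}"
          using h(1,2) root_in_basin[OF z] by (auto simp: bij_betw_def inj_on_def)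
        ultimately show ?thesis by simp
      qed
      moreover have "map_prod h h ` ?A z = (\<lambda>v. (v, f v)) ` h ` {v \<in> basin z. \<not> periodic v}"
        unfolding image_image by (rule image_cong) (use h(3) in auto)
      ultimately show ?thesis by simp
    qed
    then have "?G w = app_iso ?k (?G z)"
      using h(1) by (intro pre_digraph.equality) (auto simp: bij_betw_def)
    ultimately show ?L unfolding rooted_isomorphism_def bt using h(2) by force
  qed
qed

lemma rooted_Aut_basin_tree:
  assumes "z \<in> S" "periodic z"
  shows "rooted_Aut (basin_tree z) = {h. h permutes basin z \<and> basin_iso z z h}"
  unfolding rooted_Aut_def rooted_isomorphism_basin_tree_iff[OF assms assms]
  by (simp add: basin_tree_def)

lemma tuple_index_basin_trees:
  assumes z: "z \<in> S" "periodic z"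
  shows "tuple_index (map (\<lambda>i. basin_tree ((f ^^ i) z)) [0..<period z]) = 1 \<longleftrightarrow>
    (\<forall>k. 0 < k \<and> k < period z \<longrightarrow>
      \<not> (\<forall>i. \<exists>h. basin_iso ((f ^^ (i + k)) z) ((f ^^ i) z) h))"
proof -
  let ?m = "period z" and ?Ts = "map (\<lambda>i. basin_tree ((f ^^ i) z)) [0..<period z]"
  have m: "?m > 0" using period_props(1)[OF z(2)] .
  have iso: "rooted_isomorphic (basin_tree ((f ^^ i) z)) (basin_tree ((f ^^ j) z)) \<longleftrightarrow>
      (\<exists>h. basin_iso ((f ^^ i) z) ((f ^^ j) z) h)" for i j
    using rooted_isomorphism_basin_tree_iff funpow_in[OF z(1)] periodic_funpow[OF z(2)]
    by (simp add: rooted_isomorphic_def)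
  have md: "(f ^^ (i mod ?m)) z = (f ^^ i) z" for i
    using funpow_mod_eq[OF period_props(2)[OF z(2)]] .
  have "tuple_index ?Ts = 1 \<longleftrightarrow> (\<forall>k. 0 < k \<and> k < length ?Ts \<longrightarrow>
      \<not> (\<forall>i<length ?Ts. rooted_isomorphic (?Ts ! ((i + k) mod length ?Ts)) (?Ts ! i)))"
  proof (rule tuple_index_eq_1_iff)
    show "?Ts \<noteq> []" using m by simp
    show "rooted_isomorphic T T" if "T \<in> set ?Ts" for T
      using that basin_iso_id iso by auto
    show "rooted_isomorphic U T" if "T \<in> set ?Ts" "U \<in> set ?Ts" "rooted_isomorphic T U" for T U
      using that iso basin_iso_inv funpow_in[OF z(1)] periodic_funpow[OF z(2)] by auto metis
  qed
  also have "\<dots> \<longleftrightarrow> (\<forall>k. 0 < k \<and> k < ?m \<longrightarrow>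
      \<not> (\<forall>i<?m. \<exists>h. basin_iso ((f ^^ (i + k)) z) ((f ^^ i) z) h))"
    using m by (simp add: iso md)
  also have "\<dots> \<longleftrightarrow> (\<forall>k. 0 < k \<and> k < ?m \<longrightarrow>
      \<not> (\<forall>i. \<exists>h. basin_iso ((f ^^ (i + k)) z) ((f ^^ i) z) h))"
  proof -
    have "(f ^^ (i mod ?m + k)) z = (f ^^ (i + k)) z" for i k
      by (metis md mod_add_left_eq)
    then have "(\<forall>i<?m. \<exists>h. basin_iso ((f ^^ (i + k)) z) ((f ^^ i) z) h) \<longleftrightarrow>
        (\<forall>i. \<exists>h. basin_iso ((f ^^ (i + k)) z) ((f ^^ i) z) h)" for k
      using m md by (metis mod_less_divisor)
    then show ?thesis by simp
  qed
  finally show ?thesis .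
qed


section \<open>Rigid self-maps\<close>

text \<open>
  The three conditions remove, in this order, the three ways in which \<open>g\<close> can move \<open>x\<close>: to another
  component, to another tree of the same component, and inside its tree.
\<close>
lemma C_bij_eq_id:
  assumes iso: "\<And>C D. C \<in> weak_components \<Gamma> \<Longrightarrow> D \<in> weak_components \<Gamma> \<Longrightarrow> C \<noteq> D \<Longrightarrow>
      \<not> digraph_iso C D"
    and trees: "\<And>C Ts. C \<in> weak_components \<Gamma> \<Longrightarrow> is_tree_tuple C Ts \<Longrightarrow>
      tuple_index Ts = 1 \<and> (\<forall>T \<in> set Ts. card (rooted_Aut T) = 1)"
    and g: "g \<in> C_bij S f"
  shows "g = id"
proof
  fix x
  show "g x = id x"
  proof (cases "x \<in> S")
    case False
    then show ?thesis using permutes_not_in[OF C_bijD(1)[OF g]] by simp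
  next
    case x: True
    have gx: "g x \<in> S" using C_bijD(3)[OF g x] .
    have "digraph_iso (\<Gamma> \<restriction> component x) (\<Gamma> \<restriction> component (g x))"
      using C_bij_component[OF g x] C_bijD(2)[OF g] component_subset
      unfolding digraph_iso_component_iff by blast
    then have "\<Gamma> \<restriction> component x = \<Gamma> \<restriction> component (g x)"
      using iso x gx by (auto simp: weak_components_eq)
    then have comp: "component (g x) = component x" by (metis induce_subgraph_verts)
    define z where "z = entry x"
    have z: "z \<in> S" "periodic z" "z \<in> component x"
      using x by (simp_all add: z_def entry_in entry_periodic entry_in_component)
    define Ts where "Ts = map (\<lambda>i. basin_tree ((f ^^ i) z)) [0..<period z]"
    have Ts: "tuple_index Ts = 1" "\<And>T. T \<in> set Ts \<Longrightarrow> card (rooted_Aut T) = 1"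
    proof -
      have "is_tree_tuple (\<Gamma> \<restriction> component x) Ts"
        unfolding is_tree_tuple_component_iff[OF x] using z Ts_def by blast
      then show "tuple_index Ts = 1" "\<And>T. T \<in> set Ts \<Longrightarrow> card (rooted_Aut T) = 1"
        using trees x by (auto simp: weak_components_eq)
    qed
    have "g z \<in> component z"
      using entry_in_component[OF gx] comp component_eq[OF x z(3)] C_bij_entry[OF g x] z_def by simp
    then obtain r where r: "r < period z" "g z = (f ^^ r) z"
      using periodic_same_component_less[OF z(2)] C_bij_periodic[OF g z(1)] z(2) by blast
    have shift: "\<exists>h. basin_iso ((f ^^ (i + r)) z) ((f ^^ i) z) h" for i
    proof -
      have "g ((f ^^ i) z) = (f ^^ (i + r)) z"
        using C_bij_funpow[OF g z(1)] r(2) by (simp add: funpow_add)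
      then have "basin_iso ((f ^^ i) z) ((f ^^ (i + r)) z) g"
        using C_bij_basin_iso[OF g funpow_in[OF z(1), of i]] by simp
      then show ?thesis using basin_iso_inv funpow_in[OF z(1)] periodic_funpow[OF z(2)] by blast
    qed
    have "\<forall>k. 0 < k \<and> k < period z \<longrightarrow>
        \<not> (\<forall>i. \<exists>h. basin_iso ((f ^^ (i + k)) z) ((f ^^ i) z) h)"
      using Ts(1) unfolding Ts_def tuple_index_basin_trees[OF z(1,2)] .
    from spec[OF this, of r] have "r = 0" using shift r(1) by simp
    then have "g z = z" using r(2) by simp
    then have giso: "basin_iso z z g" using C_bij_basin_iso[OF g z(1)] by simp
    \<comment> \<open>Tree automorphisms are recorded as the identity off the tree, so \<open>g\<close> is cut down to its basin.\<close>
    define a where "a = (\<lambda>v. if v \<in> basin z then g v else v)"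
    have "bij_betw a (basin z) (basin z)"
      using giso bij_betw_cong[of "basin z" a g] by (simp add: a_def basin_iso_def)
    then have "a permutes basin z" by (intro bij_imp_permutes) (simp_all add: a_def)
    moreover have "basin_iso z z a"
      using giso \<open>bij_betw a _ _\<close> root_in_basin[OF z(1,2)] basin_step
      by (simp add: basin_iso_def a_def)
    ultimately have "a \<in> rooted_Aut (basin_tree z)" "id \<in> rooted_Aut (basin_tree z)"
      using basin_iso_id by (simp_all add: rooted_Aut_basin_tree[OF z(1,2)] permutes_id)
    moreover have "basin_tree z \<in> set Ts"
      using period_props(1)[OF z(2)] by (force simp: Ts_def)
    ultimately have "a = id" using Ts(2) by (metis card_1_singletonE singletonD)
    moreover have "x \<in> basin z" using x by (simp add: basin_def z_def)
    ultimately show ?thesis by (metis a_def)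
  qed
qed

text \<open>
  An isomorphism of two components and its inverse together form an involution of \<open>S\<close> that commutes
  with \<open>f\<close> and exchanges the two components.
\<close>
lemma not_iso_components:
  assumes triv: "C_bij S f = {id}" and x: "x \<in> S" and y: "y \<in> S"
    and ne: "component x \<noteq> component y"
  shows "\<not> digraph_iso (\<Gamma> \<restriction> component x) (\<Gamma> \<restriction> component y)"
proof
  assume "digraph_iso (\<Gamma> \<restriction> component x) (\<Gamma> \<restriction> component y)"
  then obtain h where h: "bij_betw h (component x) (component y)"
    "\<And>v. v \<in> component x \<Longrightarrow> h (f v) = f (h v)" unfolding digraph_iso_component_iff by blast
  let ?k = "inv_into (component x) h"
  have disj: "v \<notin> component y" if "v \<in> component x" for v
    using that ne component_eq[OF x] component_eq[OF y] by blast
  have hk: "h v \<in> component y" "?k (h v) = v" if "v \<in> component x" for v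
    using that h(1) by (auto simp: bij_betw_inv_into_left bij_betw_apply)
  have kh: "?k v \<in> component x" "h (?k v) = v" if "v \<in> component y" for v
    using that h(1) bij_betw_inv_into[OF h(1)]
    by (auto simp: bij_betw_inv_into_right bij_betw_apply)
  define g where "g v = (if v \<in> component x then h v else if v \<in> component y then ?k v else v)" for v
  have "g \<in> C_bij S f"
  proof (rule in_C_bijI)
    show "g v \<in> S" if "v \<in> S" for v
      using that hk(1) kh(1) component_subset unfolding g_def by auto
    have "g (g v) = v" for v
    proof (cases "v \<in> component x")
      case True
      then show ?thesis using hk[OF True] disj[of "h v"] by (auto simp: g_def)
    next
      case False
      then show ?thesis using kh[of v] by (auto simp: g_def)
    qed
    then show "inj_on g S" by (metis inj_on_inverseI)
    show "g v = v" if "v \<notin> S" for v using that component_subset unfolding g_def by auto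
    show "g (f v) = f (g v)" if v: "v \<in> S" for v
    proof -
      have "?k (f v) = f (?k v)" if "v \<in> component y"
        using h(2)[OF kh(1)[OF that]] hk(2)[OF component_step[OF kh(1)[OF that]]] kh(2)[OF that]
        by simp
      then show ?thesis using h(2) component_step_iff[OF v] by (simp add: g_def)
    qed
  qed
  then have "g x = x" using triv by auto
  then show False using hk(1) disj component_refl[OF x] by (metis g_def)
qed

lemma glue_eq_id:
  assumes triv: "C_bij S f = {id}"
    and iso: "\<And>z. z \<in> S \<Longrightarrow> periodic z \<Longrightarrow> basin_iso z (\<sigma> z) (h z)"
    and inj: "inj_on \<sigma> {z \<in> S. periodic z}"
    and comm: "\<And>z. z \<in> S \<Longrightarrow> periodic z \<Longrightarrow> \<sigma> (f z) = f (\<sigma> z)"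
    and x: "x \<in> S"
  shows "h (entry x) x = x"
proof -
  have "(\<lambda>x. if x \<in> S then h (entry x) x else x) = id"
    using glue_basin_isos[of \<sigma> h, OF iso inj comm] unfolding triv by simp
  from fun_cong[OF this, of x] show ?thesis using x by simp
qed

text \<open>
  If every tree along the cycle is isomorphic to the one \<open>k\<close> steps ahead, then rotating the cycle
  back by \<open>k\<close> steps extends to a permutation commuting with \<open>f\<close>, which moves \<open>z\<close>.
\<close>
lemma no_proper_shift:
  assumes triv: "C_bij S f = {id}" and z: "z \<in> S" "periodic z"
    and k: "0 < k" "k < period z"
  shows "\<not> (\<forall>i. \<exists>h. basin_iso ((f ^^ (i + k)) z) ((f ^^ i) z) h)"
proof
  assume shift: "\<forall>i. \<exists>h. basin_iso ((f ^^ (i + k)) z) ((f ^^ i) z) h"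
  let ?m = "period z"
  \<comment> \<open>Going back by \<open>k\<close> steps on a cycle of length \<open>?m\<close> is going forward by \<open>?m - k\<close> steps.\<close>
  define \<sigma> where "\<sigma> w = (if w \<in> component z then (f ^^ (?m - k)) w else w)" for w
  have returns: "(f ^^ k) ((f ^^ (?m - k)) w) = w" "\<exists>j. w = (f ^^ j) z"
    if w: "periodic w" "w \<in> component z" for w
  proof -
    obtain j where j: "w = (f ^^ j) z" using periodic_same_component[OF w] by blast
    then show "\<exists>j. w = (f ^^ j) z" ..
    have "(f ^^ k) ((f ^^ (?m - k)) w) = (f ^^ ?m) w"
      using k by (metis add_diff_inverse_nat comp_apply funpow_add less_imp_not_less)
    also have "\<dots> = (f ^^ j) ((f ^^ ?m) z)" by (metis j add.commute comp_apply funpow_add)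
    also have "\<dots> = w" using period_props(2)[OF z(2)] j by simp
    finally show "(f ^^ k) ((f ^^ (?m - k)) w) = w" .
  qed
  have "\<exists>h. basin_iso w (\<sigma> w) h" if w: "w \<in> S" "periodic w" for w
  proof (cases "w \<in> component z")
    case True
    then obtain j where j: "w = (f ^^ j) z" using returns(2) w by blast
    have \<sigma>w: "\<sigma> w = (f ^^ (?m - k + j)) z" using True j by (simp add: \<sigma>_def funpow_add)
    have "(f ^^ (?m - k + j + k)) z = (f ^^ k) (\<sigma> w)"
      unfolding \<sigma>w by (metis add.commute comp_apply funpow_add)
    also have "\<dots> = w" using returns(1)[OF w(2) True] True by (simp add: \<sigma>_def)
    finally show ?thesis using shift \<sigma>w by metis
  next
    case False
    then show ?thesis using basin_iso_id by (auto simp: \<sigma>_def)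
  qed
  then obtain h where h: "\<And>w. w \<in> S \<Longrightarrow> periodic w \<Longrightarrow> basin_iso w (\<sigma> w) (h w)" by metis
  have in_comp: "\<sigma> w \<in> component z \<longleftrightarrow> w \<in> component z" if "w \<in> S" for w
    using that funpow_in_component component_trans by (auto simp: \<sigma>_def)
  have "h (entry z) z = z"
  proof (rule glue_eq_id[OF triv h])
    show "inj_on \<sigma> {z \<in> S. periodic z}"
    proof (rule inj_onI, safe)
      fix u v assume uv: "u \<in> S" "v \<in> S" "periodic u" "periodic v" "\<sigma> u = \<sigma> v"
      then have "u \<in> component z \<longleftrightarrow> v \<in> component z" using in_comp by metis
      then show "u = v" using uv returns(1) unfolding \<sigma>_def by metis
    qed
    show "\<sigma> (f w) = f (\<sigma> w)" if "w \<in> S" for w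
      using component_step_iff[OF that] by (simp add: \<sigma>_def funpow_swap1[of f])
  qed (use z in auto)
  moreover have "h (entry z) z = (f ^^ (?m - k)) z"
    using h[OF z] z component_refl by (simp add: entry_of_periodic basin_iso_def \<sigma>_def)
  ultimately show False using period_props(3)[OF z(2), of "?m - k"] k by simp
qed

text \<open>
  An automorphism of one tree glues with the identity on all other trees.
\<close>
lemma rooted_Aut_trivial:
  assumes triv: "C_bij S f = {id}" and w: "w \<in> S" "periodic w"
  shows "rooted_Aut (basin_tree w) = {id}"
proof -
  have "a = id" if a: "a permutes basin w" "basin_iso w w a" for a
  proof
    fix v
    show "a v = id v"
    proof (cases "v \<in> basin w")
      case True
      have "(if entry v = w then a else id) v = v"
        by (rule glue_eq_id[OF triv, where \<sigma> = id and h = "\<lambda>u. if u = w then a else id"])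
          (use a(2) basin_iso_id True in \<open>auto simp: basin_def\<close>)
      then show ?thesis using True by (simp add: basin_def)
    next
      case False
      then show ?thesis using permutes_not_in[OF a(1)] by simp
    qed
  qed
  then show ?thesis unfolding rooted_Aut_basin_tree[OF w]
    using basin_iso_id permutes_id by auto
qed

lemma card_C_bij_eq_1_iff_only_id: "card (C_bij S f) = 1 \<longleftrightarrow> C_bij S f = {id}"
  using id_in_C_bij by (metis card_1_singletonE is_singletonI is_singleton_altdef singletonD)

lemma card_C_bij_pos: "1 \<le> card (C_bij S f)"
proof -
  have "finite (C_bij S f)"
    using finite_subset[OF _ finite_permutations[OF finite_S]] by (auto simp: C_bij_def)
  then show ?thesis using id_in_C_bij by (metis One_nat_def Suc_leI card_gt_0_iff empty_iff)
qed

theorem card_C_bij_eq_1_iff_rigid: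
  "card (C_bij S f) = 1 \<longleftrightarrow>
     (\<forall>C \<in> weak_components \<Gamma>. \<forall>D \<in> weak_components \<Gamma>. C \<noteq> D \<longrightarrow> \<not> digraph_iso C D) \<and>
     (\<forall>C \<in> weak_components \<Gamma>. \<forall>Ts. is_tree_tuple C Ts \<longrightarrow>
        tuple_index Ts = 1 \<and> (\<forall>T \<in> set Ts. card (rooted_Aut T) = 1))"
  (is "_ \<longleftrightarrow> ?iso \<and> ?trees")
  unfolding card_C_bij_eq_1_iff_only_id
proof (intro iffI conjI)
  assume triv: "C_bij S f = {id}"
  show ?iso
  proof (intro ballI impI)
    fix C D assume "C \<in> weak_components \<Gamma>" "D \<in> weak_components \<Gamma>" "C \<noteq> D"
    then obtain x y where "x \<in> S" "y \<in> S" and CD: "C = \<Gamma> \<restriction> component x" "D = \<Gamma> \<restriction> component y"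
      unfolding weak_components_eq by blast
    moreover from this have "component x \<noteq> component y" using \<open>C \<noteq> D\<close> by auto
    ultimately show "\<not> digraph_iso C D" unfolding CD by (intro not_iso_components[OF triv])
  qed
  show ?trees
  proof (intro ballI allI impI)
    fix C Ts assume "C \<in> weak_components \<Gamma>" "is_tree_tuple C Ts"
    then obtain z where z: "z \<in> S" "periodic z"
      and Ts: "Ts = map (\<lambda>i. basin_tree ((f ^^ i) z)) [0..<period z]"
      unfolding weak_components_eq using is_tree_tuple_component_iff component_subset by blast
    show "tuple_index Ts = 1 \<and> (\<forall>T \<in> set Ts. card (rooted_Aut T) = 1)"
      using no_proper_shift[OF triv z] rooted_Aut_trivial[OF triv funpow_in[OF z(1)]]
        periodic_funpow[OF z(2)]
      unfolding Ts tuple_index_basin_trees[OF z] by simp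
  qed
next
  assume rigid: "?iso \<and> ?trees"
  have "g = id" if "g \<in> C_bij S f" for g
  proof (rule C_bij_eq_id[OF _ _ that])
    show "\<not> digraph_iso C D"
      if "C \<in> weak_components \<Gamma>" "D \<in> weak_components \<Gamma>" "C \<noteq> D" for C D
      using rigid that by simp
    show "tuple_index Ts = 1 \<and> (\<forall>T \<in> set Ts. card (rooted_Aut T) = 1)"
      if "C \<in> weak_components \<Gamma>" "is_tree_tuple C Ts" for C Ts
      using rigid that by simp
  qed
  then show "C_bij S f = {id}" using id_in_C_bij by blast
qed

end

text \<open>
  Number the points of \<open>S\<close> by \<open>h\<close> and let \<open>f\<close> lower the number by one, fixing the point numbered
  \<open>0\<close>. A commuting permutation fixes the unique fixed point of \<open>f\<close>. If it fixes \<open>f s\<close> with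
  \<open>h s > 0\<close>, then it maps \<open>s\<close> to a preimage of \<open>f s\<close> different from \<open>f s\<close>, and the only one is \<open>s\<close>.
\<close>
lemma ex_trivial_centralizer:
  assumes "finite S"
  shows "\<exists>f \<in> S \<rightarrow>\<^sub>E S. C_bij S f = {id}"
proof -
  obtain h where h: "bij_betw h S {..<card S}"
    using ex_bij_betw_finite_nat[OF assms] by (auto simp: atLeast0LessThan)
  let ?e = "inv_into S h"
  have e: "?e i \<in> S" "h (?e i) = i" if "i < card S" for i
    using that h bij_betw_inv_into[OF h]
    by (auto simp: bij_betw_inv_into_right bij_betw_apply)
  define f where "f = (\<lambda>s\<in>S. ?e (h s - 1))"
  have f: "f s \<in> S" "h (f s) = h s - 1" if "s \<in> S" for s
  proof -
    have "h s < card S" using that h by (auto simp: bij_betw_def)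
    then show "f s \<in> S" "h (f s) = h s - 1" using e[of "h s - 1"] that by (auto simp: f_def)
  qed
  have inj: "s = t" if "s \<in> S" "t \<in> S" "h s = h t" for s t
    using h that by (auto simp: bij_betw_def dest: inj_onD)
  have "g = id" if "g \<in> C_bij S f" for g
  proof -
    have g: "g permutes S" "\<And>s. s \<in> S \<Longrightarrow> f (g s) = g (f s)" "\<And>s. s \<in> S \<Longrightarrow> g s \<in> S"
      using that permutes_in_image[of g S] by (auto simp: C_bij_def)
    have "g s = s" if "s \<in> S" for s
      using that
    proof (induction "h s" arbitrary: s rule: less_induct)
      case less
      show ?case
      proof (cases "h s")
        case 0
        then have "f s = s" using inj f less.prems by simp
        then have "f (g s) = g s" using g(2)[OF less.prems] by simp
        then have "h (g s) = 0" using f(2)[OF g(3)[OF less.prems]] by simp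
        then show ?thesis using 0 inj g(3) less.prems by simp
      next
        case (Suc k)
        have fs: "g (f s) = f s" using less.hyps[of "f s"] f[OF less.prems] Suc by simp
        then have "f (g s) = f s" using g(2)[OF less.prems] by simp
        then have *: "h (g s) - 1 = k" using f(2)[OF g(3)[OF less.prems]] f(2)[OF less.prems] Suc by simp
        have "h (g s) \<noteq> 0"
        proof
          assume "h (g s) = 0"
          then have "g s = f s" using * inj f less.prems g(3) Suc by simp
          then have "g s = g (f s)" using fs by simp
          then have "s = f s" using permutes_inj[OF g(1)] by (simp add: inj_eq)
          then show False using f(2)[OF less.prems] Suc by simp
        qed
        then show ?thesis using * Suc inj g(3) less.prems by simp
      qed
    qed
    then show ?thesis using permutes_not_in[OF g(1)] by (metis eq_id_iff)
  qed
  moreover have "id \<in> C_bij S f" by (simp add: C_bij_def permutes_id)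
  ultimately have "C_bij S f = {id}" by blast
  moreover have "f \<in> S \<rightarrow>\<^sub>E S" using f(1) by (auto simp: f_def)
  ultimately show ?thesis by blast
qed

theorem proposition2p13:
  fixes S :: "'a set"
  assumes "finite S"
  shows "Min ((\<lambda>f. card (C_bij S f)) ` (S \<rightarrow>\<^sub>E S)) = 1 \<and>
    (\<forall>f \<in> S \<rightarrow>\<^sub>E S.
       card (C_bij S f) = 1 \<longleftrightarrow>
         (\<forall>C \<in> weak_components (functional_graph S f).
            \<forall>D \<in> weak_components (functional_graph S f). C \<noteq> D \<longrightarrow> \<not> digraph_iso C D) \<and>
         (\<forall>C \<in> weak_components (functional_graph S f). \<forall>Ts. is_tree_tuple C Ts \<longrightarrow>
            tuple_index Ts = 1 \<and> (\<forall>T \<in> set Ts. card (rooted_Aut T) = 1)))"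
proof (intro conjI ballI)
  have loc: "finite_self_map S f" if "f \<in> S \<rightarrow>\<^sub>E S" for f
    using that assms by unfold_locales auto
  show "Min ((\<lambda>f. card (C_bij S f)) ` (S \<rightarrow>\<^sub>E S)) = 1"
  proof (rule Min_eqI)
    show "finite ((\<lambda>f. card (C_bij S f)) ` (S \<rightarrow>\<^sub>E S))" using assms by (simp add: finite_PiE)
    show "1 \<le> n" if "n \<in> (\<lambda>f. card (C_bij S f)) ` (S \<rightarrow>\<^sub>E S)" for n
      using that finite_self_map.card_C_bij_pos[OF loc] by auto
    obtain f where "f \<in> S \<rightarrow>\<^sub>E S" "C_bij S f = {id}"
      using ex_trivial_centralizer[OF assms] by blast
    then show "1 \<in> (\<lambda>f. card (C_bij S f)) ` (S \<rightarrow>\<^sub>E S)"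
      by (intro image_eqI[of _ _ f]) simp_all
  qed
  show "card (C_bij S f) = 1 \<longleftrightarrow>
         (\<forall>C \<in> weak_components (functional_graph S f).
            \<forall>D \<in> weak_components (functional_graph S f). C \<noteq> D \<longrightarrow> \<not> digraph_iso C D) \<and>
         (\<forall>C \<in> weak_components (functional_graph S f). \<forall>Ts. is_tree_tuple C Ts \<longrightarrow>
            tuple_index Ts = 1 \<and> (\<forall>T \<in> set Ts. card (rooted_Aut T) = 1))"
    if "f \<in> S \<rightarrow>\<^sub>E S" for f
    by (rule finite_self_map.card_C_bij_eq_1_iff_rigid[OF loc[OF that]])
qed

end
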